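(* There exists an instance of the TSP-mD with Euclidean metrics $\ell,\ell'$ and all-zero payloads ($w_i=0$ for all $i$) such that $N=N^{dr}=N^{tr}$, every feasible sortie serves only one customer (i.e. has the form $(i_1,i_2,i_3)$), and all the optimal solutions are arc-retraversing.
   Context: Instance. An instance of the TSP-mD (Traveling Salesman Problem with Drones) consists of a finite set $N$ of nodes with a depot $0\in N$; the complete directed graph with arc set $A=\{(i,j)\in N\times N: i\neq j\}$; subsets $N^{tr},N^{dr}\subseteq N$ (nodes that can be served by the truck, resp. by the drones) with $N^{tr}\cup N^{dr}=N$ and $0\in N^{tr}$; two metrics $\ell,\ell'$ on $N$ ($\ell_{ij}$, resp. $\ell'_{ij}$, is the time the truck, resp. a drone, needs to traverse $(i,j)$); a number $m\ge 1$ of identical drones; a drone weight $w^{dr}>0$; payloads $w_i\ge 0$ for $i\in N^{dr}$; and a battery capacity $B>0$. Sorties. A sortie is a tuple $\pi=(i_1,\dots,i_r)$, $r\ge 3$, with $i_1,i_r\in N^{tr}$, $i_2,\dots,i_{r-1}\in N^{dr}$ and consecutive nodes distinct ($i_1=i_r$ is allowed). It serves the nodes $N[\pi]=\{i_2,\dots,i_{r-1}\}$ and has duration $\ell'_\pi=\sum_{q=1}^{r-1}\ell'_{i_qi_{q+1}}$. Its energy consumption is $w^{dr}\sum_{q=1}^{r-1}\ell'_{i_qi_{q+1}}+\sum_{p=2}^{r-1}\bigl(w_{i_p}\sum_{q=1}^{p-1}\ell'_{i_qi_{q+1}}\bigr)$, and it is feasible if this is at most $B$. Solutions. A (feasible)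 solution consists of a truck route, which is a closed walk $0=v_0,v_1,\dots,v_n=0$ with all $v_t\in N^{tr}$ and consecutive nodes distinct (nodes and arcs may be repeated), and a finite family of feasible sorties, each assigned to a drone and to a pair of visit indices $s\le e$ such that the sortie starts at $v_s$ (launch from the truck at its visit number $s$) and ends at $v_e$ (retrieval by the truck at visit number $e$). The sorties of the same drone are performed one after the other (each one is launched at or after the visit at which the previous one was retrieved, and after that retrieval). Every node of $N$ must be on the truck route or served by some sortie. The truck starts at time $0$; it may wait at nodes, a drone may wait at its landing node for the truck, a sortie with duration $\ell'_\pi$ launched while the truck is at visit $s$ lands $\ell'_\pi$ time units after launch, and the truck may not leave visit $e$ before the drone has landed. Launching, retrieving, serving and battery swapping take no time. The completion time is the earliest time at which the truck has completed its route and all drones have been retrieved at the depot or earlier; it is to be minimized over all solutions, and a solution is optimal if it attains the minimum. A solution is arc-retraversing if its truck route traverses some arc $(i,j)\in A$ (in the direction from $i$ to $j$) more than once. "Euclidean metrics" means that the nodes are points of a Euclidean space and that $\ell$ and $\ell'$ are (positive multiples of) Euclidean distances. *)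

theory Defs
  imports "HOL-Analysis.Analysis"
begin

text \<open>
  Instances. Travel times are total functions; their values outside the node set are
  irrelevant, except that \<open>Metric_space\<close> asks for nonnegativity and symmetry there as well.
\<close>

record 'v tsp_md =
  nodes :: "'v set"
  depot :: 'v
  truck_nodes :: "'v set"
  drone_nodes :: "'v set"
  truck_time :: "'v \<Rightarrow> 'v \<Rightarrow> real"
  drone_time :: "'v \<Rightarrow> 'v \<Rightarrow> real"
  num_drones :: nat
  drone_weight :: real
  payload :: "'v \<Rightarrow> real"
  battery :: real

definition tsp_md_instance :: "'v tsp_md \<Rightarrow> bool" where
  "tsp_md_instance I \<longleftrightarrow>
     finite (nodes I) \<and> depot I \<in> nodes I \<and>
     truck_nodes I \<subseteq> nodes I \<and> drone_nodes I \<subseteq> nodes I \<and>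
     truck_nodes I \<union> drone_nodes I = nodes I \<and> depot I \<in> truck_nodes I \<and>
     Metric_space (nodes I) (truck_time I) \<and> Metric_space (nodes I) (drone_time I) \<and>
     num_drones I \<ge> 1 \<and> drone_weight I > 0 \<and>
     (\<forall>i \<in> drone_nodes I. payload I i \<ge> 0) \<and> battery I > 0"

text \<open>
  The dimension \<open>d\<close> is existentially quantified, so a point of Euclidean \<open>d\<close>-space is given by its
  coordinates \<open>p i k\<close>, \<open>k < d\<close>. Both metrics refer to the same points.
\<close>

definition euclidean_metrics :: "'v tsp_md \<Rightarrow> bool" where
  "euclidean_metrics I \<longleftrightarrow>
     (\<exists>(d::nat) (p :: 'v \<Rightarrow> nat \<Rightarrow> real) (a::real) (b::real). a > 0 \<and> b > 0 \<and>
        (\<forall>i \<in> nodes I. \<forall>j \<in> nodes I.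
           truck_time I i j = a * L2_set (\<lambda>k. p i k - p j k) {..<d} \<and>
           drone_time I i j = b * L2_set (\<lambda>k. p i k - p j k) {..<d}))"


text \<open>Sorties are lists of nodes; list positions start at 0.\<close>

definition served :: "'v list \<Rightarrow> 'v set" where
  "served \<pi> = set (butlast (tl \<pi>))"

definition is_sortie :: "'v tsp_md \<Rightarrow> 'v list \<Rightarrow> bool" where
  "is_sortie I \<pi> \<longleftrightarrow>
     length \<pi> \<ge> 3 \<and> hd \<pi> \<in> truck_nodes I \<and> last \<pi> \<in> truck_nodes I \<and>
     served \<pi> \<subseteq> drone_nodes I \<and> distinct_adj \<pi>"

definition duration :: "'v tsp_md \<Rightarrow> 'v list \<Rightarrow> real" where
  "duration I \<pi> = (\<Sum>q<length \<pi> - 1. drone_time I (\<pi> ! q) (\<pi> ! Suc q))"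

definition energy :: "'v tsp_md \<Rightarrow> 'v list \<Rightarrow> real" where
  "energy I \<pi> =
     drone_weight I * (\<Sum>q<length \<pi> - 1. drone_time I (\<pi> ! q) (\<pi> ! Suc q)) +
     (\<Sum>p = 1..<length \<pi> - 1. payload I (\<pi> ! p) * (\<Sum>q<p. drone_time I (\<pi> ! q) (\<pi> ! Suc q)))"

definition feasible_sortie :: "'v tsp_md \<Rightarrow> 'v list \<Rightarrow> bool" where
  "feasible_sortie I \<pi> \<longleftrightarrow> is_sortie I \<pi> \<and> energy I \<pi> \<le> battery I"


text \<open>
  A flight is a sortie together with the visit indices of its launch and its retrieval. Drones are
  numbered \<open>0, ..., num_drones I - 1\<close>, and \<open>flights S d\<close> lists the flights of drone \<open>d\<close> in the order
  in which they are performed; \<open>flights S d\<close> is ignored for other values of \<open>d\<close>.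
  The list \<open>route S\<close> is \<open>v\<^sub>0, ..., v\<^sub>n\<close>, so \<open>n\<close> is \<open>last_visit S\<close>.
\<close>

record 'v flight =
  launch_visit :: nat
  retrieval_visit :: nat
  sortie :: "'v list"

record 'v tsp_md_solution =
  route :: "'v list"
  flights :: "nat \<Rightarrow> 'v flight list"

definition last_visit :: "'v tsp_md_solution \<Rightarrow> nat" where
  "last_visit S = length (route S) - 1"

definition truck_route :: "'v tsp_md \<Rightarrow> 'v list \<Rightarrow> bool" where
  "truck_route I vs \<longleftrightarrow>
     vs \<noteq> [] \<and> hd vs = depot I \<and> last vs = depot I \<and> set vs \<subseteq> truck_nodes I \<and> distinct_adj vs"

definition valid_flight :: "'v tsp_md \<Rightarrow> 'v tsp_md_solution \<Rightarrow> 'v flight \<Rightarrow> bool" where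
  "valid_flight I S f \<longleftrightarrow>
     feasible_sortie I (sortie f) \<and>
     launch_visit f \<le> retrieval_visit f \<and> retrieval_visit f \<le> last_visit S \<and>
     hd (sortie f) = route S ! launch_visit f \<and> last (sortie f) = route S ! retrieval_visit f"

definition solution :: "'v tsp_md \<Rightarrow> 'v tsp_md_solution \<Rightarrow> bool" where
  "solution I S \<longleftrightarrow>
     truck_route I (route S) \<and>
     (\<forall>d<num_drones I. \<forall>f \<in> set (flights S d). valid_flight I S f) \<and>
     (\<forall>d<num_drones I. \<forall>k. Suc k < length (flights S d) \<longrightarrow>
        retrieval_visit (flights S d ! k) \<le> launch_visit (flights S d ! Suc k)) \<and>
     nodes I \<subseteq> set (route S) \<union> (\<Union>d<num_drones I. \<Union>f \<in> set (flights S d). served (sortie f))"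


text \<open>
  A schedule fixes the arrival time \<open>arr t\<close> and the departure time \<open>dep t\<close> of the truck for every
  visit \<open>t\<close>, and the launch time \<open>lau d k\<close> of flight number \<open>k\<close> of drone \<open>d\<close>. The truck has completed
  its route and all drones have been retrieved at time \<open>dep (last_visit S)\<close>.
\<close>

definition retrieval_time ::
    "'v tsp_md \<Rightarrow> (nat \<Rightarrow> real) \<Rightarrow> real \<Rightarrow> 'v flight \<Rightarrow> real" where
  "retrieval_time I arr l f = max (arr (retrieval_visit f)) (l + duration I (sortie f))"

definition valid_schedule ::
    "'v tsp_md \<Rightarrow> 'v tsp_md_solution \<Rightarrow>
     (nat \<Rightarrow> real) \<Rightarrow> (nat \<Rightarrow> real) \<Rightarrow> (nat \<Rightarrow> nat \<Rightarrow> real) \<Rightarrow> bool" where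
  "valid_schedule I S arr dep lau \<longleftrightarrow>
     arr 0 = 0 \<and>
     (\<forall>t\<le>last_visit S. arr t \<le> dep t) \<and>
     (\<forall>t<last_visit S. arr (Suc t) = dep t + truck_time I (route S ! t) (route S ! Suc t)) \<and>
     (\<forall>d<num_drones I. \<forall>k<length (flights S d).
        arr (launch_visit (flights S d ! k)) \<le> lau d k \<and>
        lau d k \<le> dep (launch_visit (flights S d ! k)) \<and>
        retrieval_time I arr (lau d k) (flights S d ! k) \<le> dep (retrieval_visit (flights S d ! k))) \<and>
     (\<forall>d<num_drones I. \<forall>k. Suc k < length (flights S d) \<longrightarrow>
        retrieval_time I arr (lau d k) (flights S d ! k) \<le> lau d (Suc k))"

text \<open>
  The infimum is attained, by performing every step as early as possible.
\<close>

definition completion_time :: "'v tsp_md \<Rightarrow> 'v tsp_md_solution \<Rightarrow> real" where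
  "completion_time I S =
     Inf {dep (last_visit S) | arr dep lau. valid_schedule I S arr dep lau}"

definition optimal_solution :: "'v tsp_md \<Rightarrow> 'v tsp_md_solution \<Rightarrow> bool" where
  "optimal_solution I S \<longleftrightarrow>
     solution I S \<and> (\<forall>S'. solution I S' \<longrightarrow> completion_time I S \<le> completion_time I S')"

definition arc_retraversing :: "'v tsp_md_solution \<Rightarrow> bool" where
  "arc_retraversing S \<longleftrightarrow>
     (\<exists>s t. s < t \<and> t < last_visit S \<and>
        route S ! s = route S ! t \<and> route S ! Suc s = route S ! Suc t)"

end

theory Submission
  imports Defs
begin

text \<open>
  Two hubs, the depot \<open>0\<close> and the node \<open>1\<close>, are one truck time unit apart. Customers \<open>2\<close> and \<open>3\<close> can
  only be served by round trips from \<open>0\<close>, customer \<open>4\<close> only by a round trip from \<open>1\<close>, and each of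
  these flights takes two time units. There are two drones.
  Serving \<open>4\<close> by drone takes time \<open>1 + 2 + 1 = 4\<close>, and serving it by truck takes longer. If the
  completion time is close to \<open>4\<close>, the truck is at \<open>1\<close> around times \<open>1\<close> and \<open>3\<close>, and the drone
  serving \<open>4\<close> can do nothing else. The other drone then serves \<open>2\<close> and \<open>3\<close> in succession, so it has to be
  relaunched at \<open>0\<close> around time \<open>2\<close>. As every arc takes the truck at least one time unit,
  its route is \<open>0, 1, 0, 1, 0\<close>.
\<close>

section \<open>Schedules\<close>

lemma duration_nonneg:
  assumes "tsp_md_instance I"
  shows "duration I \<pi> \<ge> 0"
  using assms unfolding tsp_md_instance_def duration_def
  by (auto intro!: sum_nonneg simp: Metric_space.nonneg)

text \<open>
  The truck waits at every visit long enough for all flights of any drone to be performed there one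
  after the other.
\<close>

lemma solution_has_schedule:
  assumes inst: "tsp_md_instance I" and sol: "solution I S"
  shows "\<exists>arr dep lau. valid_schedule I S arr dep lau"
proof -
  define F where "F = (\<Union>d<num_drones I. set (flights S d))"
  \<comment> \<open>\<open>D\<close> bounds every single duration and \<open>K\<close> bounds the
    number of flights of each drone, so waiting \<open>K * D\<close> at a visit leaves room for all
    flights of any one drone.\<close>
  define D where "D = (\<Sum>f\<in>F. duration I (sortie f))"
  define K where "K = (\<Sum>d<num_drones I. length (flights S d))"
  define arr where "arr t = (\<Sum>u<t. real K * D + truck_time I (route S ! u) (route S ! Suc u))" for t
  define dep where "dep t = arr t + real K * D" for t
  \<comment> \<open>The offset counts from the start of the whole list \<open>flights S d\<close>,
    not from the first flight launched at this visit, which avoids bookkeeping per visit.\<close>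
  define lau where "lau d k = arr (launch_visit (flights S d ! k)) + real k * D" for d k
  have finF: "finite F" unfolding F_def by auto
  have D0: "D \<ge> 0" unfolding D_def by (intro sum_nonneg duration_nonneg inst)
  have tt: "truck_time I x y \<ge> 0" for x y
    by (rule Metric_space.nonneg) (use inst in \<open>unfold tsp_md_instance_def, elim conjE\<close>)
  have durD: "duration I (sortie (flights S d ! k)) \<le> D"
    if "d < num_drones I" "k < length (flights S d)" for d k
  proof -
    have "flights S d ! k \<in> F"
      unfolding F_def using that by (intro UN_I[of d]) simp_all
    then show ?thesis
      unfolding D_def
      by (intro member_le_sum[where f = "\<lambda>f. duration I (sortie f)"] finF duration_nonneg inst)
  qed
  have kK: "Suc k \<le> K" if "d < num_drones I" "k < length (flights S d)" for d k
    using member_le_sum[of d "{..<num_drones I}" "\<lambda>d. length (flights S d)"] that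
    unfolding K_def by auto
  have KD: "real k * D + D \<le> real K * D" if "d < num_drones I" "k < length (flights S d)" for d k
    using mult_right_mono[OF of_nat_mono[OF kK[OF that]] D0] by (simp add: algebra_simps)
  have step: "arr (Suc t) = dep t + truck_time I (route S ! t) (route S ! Suc t)" for t
    unfolding arr_def dep_def by simp
  have depge: "arr t \<le> dep t" for t unfolding dep_def using D0 by simp
  have mono: "arr i \<le> arr j" if "i \<le> j" for i j
    by (rule lift_Suc_mono_le[OF _ that]) (use step depge tt in \<open>smt (verit)\<close>)
  have mono': "dep i \<le> arr j" if "i < j" for i j
    using step[of i] tt[of "route S ! i" "route S ! Suc i"] mono[of "Suc i" j] that by simp
  have window: "lau d k \<le> dep (launch_visit (flights S d ! k)) \<and>
      retrieval_time I arr (lau d k) (flights S d ! k) \<le> dep (retrieval_visit (flights S d ! k))"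
    if "d < num_drones I" "k < length (flights S d)" for d k
  proof -
    let ?f = "flights S d ! k"
    have le: "launch_visit ?f \<le> retrieval_visit ?f"
      using sol that unfolding solution_def valid_flight_def by (meson nth_mem)
    \<comment> \<open>Whatever its retrieval visit is, the drone lands before the truck leaves the
      launch visit.\<close>
    have 1: "lau d k + duration I (sortie ?f) \<le> dep (launch_visit ?f)"
      unfolding lau_def dep_def using durD[OF that] KD[OF that] by simp
    moreover have "dep (launch_visit ?f) \<le> dep (retrieval_visit ?f)"
      unfolding dep_def using mono[OF le] by simp
    ultimately show ?thesis
      using duration_nonneg[OF inst, of "sortie ?f"] depge[of "retrieval_visit ?f"]
      unfolding retrieval_time_def by simp
  qed
  have order: "retrieval_time I arr (lau d k) (flights S d ! k) \<le> lau d (Suc k)"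
    if "d < num_drones I" "Suc k < length (flights S d)" for d k
  proof -
    let ?f = "flights S d ! k" and ?g = "flights S d ! Suc k"
    have k: "k < length (flights S d)" using that by simp
    have 1: "launch_visit ?f \<le> retrieval_visit ?f"
      using sol that k unfolding solution_def valid_flight_def by (meson nth_mem)
    have 2: "retrieval_visit ?f \<le> launch_visit ?g"
      using sol that unfolding solution_def by blast
    have "0 \<le> real (Suc k) * D" using D0 by (intro mult_nonneg_nonneg) auto
    moreover have "real (Suc k) * D = real k * D + D" by (simp add: algebra_simps)
    ultimately show ?thesis
      using durD[OF that(1) k] mono[OF 2] mono[OF 1]
      unfolding retrieval_time_def lau_def by linarith
  qed
  have "arr (launch_visit (flights S d ! k)) \<le> lau d k" for d k
    unfolding lau_def using D0 by simp
  hence "valid_schedule I S arr dep lau"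
    unfolding valid_schedule_def using step depge window order by (auto simp: arr_def)
  thus ?thesis by blast
qed

section \<open>Timing bounds forced by a valid schedule\<close>

text \<open>The schedule is arbitrary, so bounds on \<open>dep (last_visit S)\<close> proved here
  apply to every member of the set whose infimum is the completion time.\<close>

locale scheduled_solution =
  fixes I :: "'v tsp_md" and S arr dep lau
  assumes inst: "tsp_md_instance I"
    and sol: "solution I S"
    and sched: "valid_schedule I S arr dep lau"
begin

lemma route_nonempty: "route S \<noteq> []"
  using sol unfolding solution_def truck_route_def by simp

lemma visit_less: "t \<le> last_visit S \<Longrightarrow> t < length (route S)"
  using route_nonempty unfolding last_visit_def by (cases "route S") auto

lemma visitE:
  assumes "x \<in> set (route S)"
  obtains t where "t \<le> last_visit S" "route S ! t = x"
proof -
  obtain t where "t < length (route S)" "route S ! t = x"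
    using assms by (metis in_set_conv_nth)
  then show ?thesis using that[of t] unfolding last_visit_def by simp
qed

lemma route_node: "t \<le> last_visit S \<Longrightarrow> route S ! t \<in> nodes I"
  using visit_less[of t] sol inst
  unfolding solution_def truck_route_def tsp_md_instance_def by (meson nth_mem subsetD)

lemma route_first: "route S ! 0 = depot I"
  using sol route_nonempty unfolding solution_def truck_route_def by (simp add: hd_conv_nth)

lemma route_last: "route S ! last_visit S = depot I"
  using sol route_nonempty unfolding solution_def truck_route_def last_visit_def
  by (simp add: last_conv_nth)

lemma route_step_neq: "t < last_visit S \<Longrightarrow> route S ! t \<noteq> route S ! Suc t"
  using sol unfolding solution_def truck_route_def last_visit_def distinct_adj_conv_nth by auto

lemma truck_metric: "Metric_space (nodes I) (truck_time I)"
  using inst unfolding tsp_md_instance_def by simp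

lemma arr_first: "arr 0 = 0"
  using sched unfolding valid_schedule_def by simp

lemma arr_le_dep: "t \<le> last_visit S \<Longrightarrow> arr t \<le> dep t"
  using sched unfolding valid_schedule_def by simp

lemma arr_Suc: "t < last_visit S \<Longrightarrow> arr (Suc t) = dep t + truck_time I (route S ! t) (route S ! Suc t)"
  using sched unfolding valid_schedule_def by simp

text \<open>The triangle inequality collapses the walk between the two visits to a direct trip;
  waiting on the way only adds time.\<close>

lemma travel:
  assumes "i < j" "j \<le> last_visit S"
  shows "dep i + truck_time I (route S ! i) (route S ! j) \<le> arr j"
  using assms
proof (induction j)
  case (Suc j)
  show ?case
  proof (cases "i = j")
    case True
    then show ?thesis using arr_Suc Suc.prems by simp
  next
    case False
    then have "dep i + truck_time I (route S ! i) (route S ! j) \<le> arr j"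
      using Suc by simp
    moreover have "truck_time I (route S ! i) (route S ! Suc j) \<le>
        truck_time I (route S ! i) (route S ! j) + truck_time I (route S ! j) (route S ! Suc j)"
      by (rule Metric_space.triangle[OF truck_metric]) (use Suc.prems route_node in auto)
    ultimately show ?thesis using arr_Suc[of j] arr_le_dep[of j] Suc.prems by simp
  qed
qed simp

lemma depot_to_visit:
  assumes "t \<le> last_visit S"
  shows "truck_time I (depot I) (route S ! t) \<le> arr t"
proof (cases "t = 0")
  case True
  then show ?thesis
    using arr_first route_first Metric_space.mdist_zero[OF truck_metric, of "depot I"] inst
    unfolding tsp_md_instance_def by auto
next
  case False
  then show ?thesis
    using travel[of 0 t] assms arr_first arr_le_dep[of 0] route_first by simp
qed

lemma visit_to_depot:
  assumes "t \<le> last_visit S"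
  shows "dep t + truck_time I (route S ! t) (depot I) \<le> dep (last_visit S)"
proof (cases "t = last_visit S")
  case True
  then show ?thesis
    using route_last Metric_space.mdist_zero[OF truck_metric, of "depot I"] inst
    unfolding tsp_md_instance_def by auto
next
  case False
  then show ?thesis
    using travel[of t "last_visit S"] assms arr_le_dep[of "last_visit S"] route_last by simp
qed

lemma dep_le_end: "t \<le> last_visit S \<Longrightarrow> dep t \<le> dep (last_visit S)"
  using visit_to_depot[of t] Metric_space.nonneg[OF truck_metric, of "route S ! t" "depot I"] by simp

lemma arr_nonneg: "t \<le> last_visit S \<Longrightarrow> 0 \<le> arr t"
  using depot_to_visit[of t] Metric_space.nonneg[OF truck_metric, of "depot I" "route S ! t"] by simp

text \<open>Consecutive visits are at distinct nodes, so each step costs at least one unit. This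
  turns a bound on time into a bound on the length of the route.\<close>

lemma number_of_arcs_le:
  assumes "\<And>x y. x \<in> nodes I \<Longrightarrow> y \<in> nodes I \<Longrightarrow> x \<noteq> y \<Longrightarrow> truck_time I x y \<ge> 1"
    and "t \<le> last_visit S"
  shows "real t \<le> arr t"
  using assms(2)
proof (induction t)
  case 0
  then show ?case using arr_first by simp
next
  case (Suc t)
  then show ?case
    using arr_Suc[of t] arr_le_dep[of t] route_step_neq[of t]
      assms(1)[OF route_node[of t] route_node[of "Suc t"]] by simp
qed

lemma flightD:
  assumes "d < num_drones I" "k < length (flights S d)"
  defines "f \<equiv> flights S d ! k"
  shows "feasible_sortie I (sortie f)"
    and "launch_visit f \<le> last_visit S" "retrieval_visit f \<le> last_visit S"
    and "launch_visit f \<le> retrieval_visit f"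
    and "hd (sortie f) = route S ! launch_visit f"
    and "last (sortie f) = route S ! retrieval_visit f"
    and "arr (launch_visit f) \<le> lau d k" "lau d k \<le> dep (launch_visit f)"
    and "lau d k + duration I (sortie f) \<le> dep (retrieval_visit f)"
    and "arr (retrieval_visit f) \<le> dep (retrieval_visit f)"
proof -
  have "f \<in> set (flights S d)"
    unfolding f_def using assms(2) by simp
  then have "valid_flight I S f"
    using sol assms(1) unfolding solution_def by blast
  then show "feasible_sortie I (sortie f)"
    "launch_visit f \<le> last_visit S" "retrieval_visit f \<le> last_visit S"
    "launch_visit f \<le> retrieval_visit f"
    "hd (sortie f) = route S ! launch_visit f" "last (sortie f) = route S ! retrieval_visit f"
    unfolding valid_flight_def by auto
  have "arr (launch_visit f) \<le> lau d k \<and> lau d k \<le> dep (launch_visit f) \<and>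
      retrieval_time I arr (lau d k) f \<le> dep (retrieval_visit f)"
    using sched assms(1,2) unfolding valid_schedule_def f_def by blast
  then show "arr (launch_visit f) \<le> lau d k" "lau d k \<le> dep (launch_visit f)"
    "lau d k + duration I (sortie f) \<le> dep (retrieval_visit f)"
    "arr (retrieval_visit f) \<le> dep (retrieval_visit f)"
    unfolding retrieval_time_def by simp_all
qed

lemma flight_within:
  assumes "d < num_drones I" "k < length (flights S d)"
  shows "0 \<le> lau d k" "lau d k + duration I (sortie (flights S d ! k)) \<le> dep (last_visit S)"
  using flightD(2,3,7,9)[OF assms] arr_nonneg[of "launch_visit (flights S d ! k)"]
    dep_le_end[of "retrieval_visit (flights S d ! k)"] by linarith+

lemma flights_sequential:
  assumes "d < num_drones I" "j < k" "k < length (flights S d)"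
  shows "lau d j + duration I (sortie (flights S d ! j)) \<le> lau d k"
  using assms(2,3)
proof (induction k)
  case (Suc k)
  have *: "lau d k + duration I (sortie (flights S d ! k)) \<le> lau d (Suc k)"
    using sched assms(1) Suc.prems unfolding valid_schedule_def retrieval_time_def by simp
  show ?case
  proof (cases "j = k")
    case False
    then show ?thesis
      using Suc * duration_nonneg[OF inst, of "sortie (flights S d ! k)"] by simp
  qed (use * in simp)
qed simp

lemma served_by_flight:
  assumes "x \<in> nodes I" "x \<notin> set (route S)"
  obtains d k where "d < num_drones I" "k < length (flights S d)" "x \<in> served (sortie (flights S d ! k))"
proof -
  have "nodes I \<subseteq> set (route S) \<union> (\<Union>d<num_drones I. \<Union>f \<in> set (flights S d). served (sortie f))"
    using sol unfolding solution_def by (elim conjE)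
  with assms have "x \<in> (\<Union>d<num_drones I. \<Union>f \<in> set (flights S d). served (sortie f))"
    by (meson UnE subsetD)
  then obtain d f where df: "d < num_drones I" "f \<in> set (flights S d)" "x \<in> served (sortie f)"
    by (elim UN_E) simp
  from df(2) obtain k where k: "k < length (flights S d)" "flights S d ! k = f"
    by (metis in_set_conv_nth)
  show ?thesis by (rule that[of d k]) (use df k in simp_all)
qed

end

section \<open>From schedules to the completion time\<close>

lemma completion_time_le:
  assumes "tsp_md_instance I" "solution I S" "valid_schedule I S arr dep lau"
  shows "completion_time I S \<le> dep (last_visit S)"
  unfolding completion_time_def
proof (rule cInf_lower)
  show "bdd_below {dep (last_visit S) |arr dep lau. valid_schedule I S arr dep lau}"
  proof (rule bdd_belowI[of _ 0], clarify)
    fix arr dep lau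
    assume "valid_schedule I S arr dep lau"
    then interpret scheduled_solution I S arr dep lau using assms by unfold_locales
    show "0 \<le> dep (last_visit S)"
      using arr_nonneg[of "last_visit S"] arr_le_dep[of "last_visit S"] by simp
  qed
qed (use assms in blast)

text \<open>A lower bound for all members passes to a real infimum only if the set is nonempty,
  which is what \<open>solution_has_schedule\<close> supplies.\<close>

lemma completion_time_ge:
  assumes "tsp_md_instance I" "solution I S"
    and "\<And>arr dep lau. valid_schedule I S arr dep lau \<Longrightarrow> T \<le> dep (last_visit S)"
  shows "T \<le> completion_time I S"
  unfolding completion_time_def
  by (rule cInf_greatest) (use solution_has_schedule[OF assms(1,2)] assms(3) in auto)

text \<open>Extracts one concrete schedule from the infimum, at the price of a strict bound. Hence
  the later analysis leaves some slack above the optimal value.\<close>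

lemma completion_time_less:
  assumes "tsp_md_instance I" "solution I S" "completion_time I S < T"
  obtains arr dep lau where "valid_schedule I S arr dep lau" "dep (last_visit S) < T"
proof -
  have "{dep (last_visit S) |arr dep lau. valid_schedule I S arr dep lau} \<noteq> {}"
    using solution_has_schedule[OF assms(1,2)] by auto
  from cInf_lessD[OF this assms(3)[unfolded completion_time_def]] show ?thesis
    using that by auto
qed

section \<open>The instance\<close>

text \<open>The complex numbers serve as the Euclidean plane. Customers 2 and 3 lie at distance 5
  from hub 0, perpendicular to the line of the hubs; customer 4 lies on that line, 5 beyond hub 1.
  Dividing by 4 for the truck and by 5 for the drones puts the hubs one truck unit apart and each
  customer one drone unit from its hub.\<close>

definition pos :: "nat \<Rightarrow> complex" where
  "pos i = (if i = 0 then 0 else if i = 1 then 4 else if i = 2 then Complex 0 5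
    else if i = 3 then Complex 0 (-5) else 9)"

text \<open>
  A flight to a customer at distance \<open>5\<close> and back uses up the battery. As distinct nodes have
  distance at least \<open>4\<close>, a sortie with three arcs would need \<open>12 / 5 > 2\<close>.
\<close>

definition two_hubs :: "nat tsp_md" where
  "two_hubs = \<lparr>nodes = {..4}, depot = 0, truck_nodes = {..4}, drone_nodes = {..4},
     truck_time = (\<lambda>i j. dist (pos i) (pos j) / 4),
     drone_time = (\<lambda>i j. dist (pos i) (pos j) / 5),
     num_drones = 2, drone_weight = 1, payload = (\<lambda>_. 0), battery = 2\<rparr>"

lemma two_hubs_simps [simp]:
  "nodes two_hubs = {..4}" "depot two_hubs = 0" "truck_nodes two_hubs = {..4}"
  "drone_nodes two_hubs = {..4}" "truck_time two_hubs i j = dist (pos i) (pos j) / 4"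
  "drone_time two_hubs i j = dist (pos i) (pos j) / 5" "num_drones two_hubs = 2"
  "drone_weight two_hubs = 1" "payload two_hubs i = 0" "battery two_hubs = 2"
  by (simp_all add: two_hubs_def)

lemma node_cases: "i \<in> {..4::nat} \<Longrightarrow> i = 0 \<or> i = 1 \<or> i = 2 \<or> i = 3 \<or> i = 4"
  by auto

section \<open>Distances between the nodes\<close>

lemma dist_complex: "dist z w = sqrt ((Re z - Re w)\<^sup>2 + (Im z - Im w)\<^sup>2)"
  by (simp add: dist_norm cmod_def)

text \<open>The two hubs are the closest pair. The bound makes every truck arc cost at least 1 and
  every drone arc at least 4/5.\<close>

lemma dist_pos_ge_4: "i \<in> {..4} \<Longrightarrow> j \<in> {..4} \<Longrightarrow> i \<noteq> j \<Longrightarrow> 4 \<le> dist (pos i) (pos j)"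
  by (drule node_cases, drule node_cases)
    (elim disjE; simp add: dist_complex pos_def; rule real_le_rsqrt; simp)

lemma dist_pos_01: "dist (pos 0) (pos 1) = 4"
  by (simp add: dist_complex pos_def)

lemma dist_pos_04: "dist (pos 0) (pos 4) = 9"
  by (simp add: dist_complex pos_def)

lemma dist_pos_14: "dist (pos 1) (pos 4) = 5"
  by (simp add: dist_complex pos_def)

text \<open>The value 6 is rough but sufficient: with a leg of length 5 from the hub, or with a
  second leg of this kind, it exceeds the total length 10 that the battery allows.\<close>

lemma dist_pos_4_ge: "i \<in> {..4} \<Longrightarrow> i \<noteq> 4 \<Longrightarrow> i \<noteq> 1 \<Longrightarrow> 6 \<le> dist (pos i) (pos 4)"
  by (drule node_cases) (elim disjE; simp add: dist_complex pos_def; rule real_le_rsqrt; simp)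

lemma dist_pos_0: "c = 2 \<or> c = 3 \<Longrightarrow> dist (pos 0) (pos c) = 5"
  by (elim disjE; simp add: dist_complex pos_def)

lemma dist_pos_23_ge:
  "c = 2 \<or> c = 3 \<Longrightarrow> i \<in> {..4} \<Longrightarrow> i \<noteq> c \<Longrightarrow> i \<noteq> 0 \<Longrightarrow> 6 \<le> dist (pos i) (pos c)"
  by (drule node_cases) (elim disjE; simp add: dist_complex pos_def; rule real_le_rsqrt; simp)

lemma Metric_space_pos:
  assumes "c > 0"
  shows "Metric_space {..4} (\<lambda>i j. dist (pos i) (pos j) / c)"
proof
  fix i j k :: nat
  show "dist (pos i) (pos j) / c = 0 \<longleftrightarrow> i = j" if "i \<in> {..4}" "j \<in> {..4}"
    using dist_pos_ge_4[OF that] assms by (cases "i = j") auto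
  show "dist (pos i) (pos k) / c \<le> dist (pos i) (pos j) / c + dist (pos j) (pos k) / c"
    using dist_triangle[of "pos i" "pos k" "pos j"] assms by (simp add: field_simps)
qed (use assms in \<open>auto simp: dist_commute\<close>)

lemma two_hubs_instance: "tsp_md_instance two_hubs"
  using Metric_space_pos[of 4] Metric_space_pos[of 5]
  unfolding tsp_md_instance_def two_hubs_def by simp

lemma two_hubs_euclidean: "euclidean_metrics two_hubs"
proof -
  define p where "p i k = (if k = 0 then Re (pos i) else Im (pos i))" for i and k :: nat
  have "L2_set (\<lambda>k. p i k - p j k) {..<2} = dist (pos i) (pos j)" for i j
    by (simp add: p_def L2_set_def dist_complex numeral_2_eq_2)
  then show ?thesis
    unfolding euclidean_metrics_def
    by (intro exI[of _ "2::nat"] exI[of _ p] exI[of _ "1/4::real"] exI[of _ "1/5::real"]) simp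
qed

section \<open>Feasible sorties of the instance\<close>

lemma sortie_nodes:
  assumes "is_sortie I \<pi>" "tsp_md_instance I"
  shows "set \<pi> \<subseteq> nodes I"
proof -
  have "length \<pi> \<ge> 3" using assms(1) unfolding is_sortie_def by (elim conjE)
  then have "\<pi> = hd \<pi> # tl \<pi> \<and> tl \<pi> \<noteq> []"
    by (cases \<pi>; cases "tl \<pi>"; simp)
  then have "\<pi> = hd \<pi> # butlast (tl \<pi>) @ [last \<pi>]"
    by (metis append_butlast_last_id last_tl)
  from arg_cong[OF this, of set] have "set \<pi> = {hd \<pi>, last \<pi>} \<union> served \<pi>"
    unfolding served_def by simp
  moreover have "hd \<pi> \<in> nodes I" "last \<pi> \<in> nodes I" "served \<pi> \<subseteq> nodes I"
    using assms unfolding is_sortie_def tsp_md_instance_def by (meson subset_iff)+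
  ultimately show ?thesis by simp
qed

lemma energy_two_hubs: "energy two_hubs \<pi> = duration two_hubs \<pi>"
  unfolding energy_def duration_def by simp

lemma duration_two_hubs_ge:
  assumes "is_sortie two_hubs \<pi>"
  shows "4/5 * real (length \<pi> - 1) \<le> duration two_hubs \<pi>"
proof -
  have "4 / 5 \<le> drone_time two_hubs (\<pi> ! q) (\<pi> ! Suc q)" if "q < length \<pi> - 1" for q
  proof -
    have "set \<pi> \<subseteq> {..4}"
      using sortie_nodes[OF assms two_hubs_instance] by simp
    moreover have "q < length \<pi>" "Suc q < length \<pi>" using that by simp_all
    ultimately have "\<pi> ! q \<in> {..4}" "\<pi> ! Suc q \<in> {..4}"
      using nth_mem by blast+
    moreover have "\<pi> ! q \<noteq> \<pi> ! Suc q"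
      using assms \<open>Suc q < length \<pi>\<close> unfolding is_sortie_def distinct_adj_conv_nth by blast
    ultimately have "4 \<le> dist (pos (\<pi> ! q)) (pos (\<pi> ! Suc q))" by (rule dist_pos_ge_4)
    then show ?thesis by simp
  qed
  then have "(\<Sum>q<length \<pi> - 1. 4/5) \<le> duration two_hubs \<pi>"
    unfolding duration_def by (intro sum_mono) simp
  then show ?thesis by simp
qed

lemma feasible_sortie_length:
  assumes "feasible_sortie two_hubs \<pi>"
  shows "length \<pi> = 3"
proof -
  have "is_sortie two_hubs \<pi>" "duration two_hubs \<pi> \<le> 2" "3 \<le> length \<pi>"
    using assms unfolding feasible_sortie_def is_sortie_def by (auto simp: energy_two_hubs)
  then show ?thesis using duration_two_hubs_ge[of \<pi>] by linarith
qed

lemma duration_two_hubs: "duration two_hubs [x, c, y] = (dist (pos x) (pos c) + dist (pos y) (pos c)) / 5"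
  by (simp add: duration_def numeral_2_eq_2 dist_commute)

text \<open>The bound 10 is the battery 2 times the drone scaling factor 5.\<close>

lemma feasible_sortieE:
  assumes "feasible_sortie two_hubs \<pi>" "c \<in> served \<pi>"
  obtains x y where "\<pi> = [x, c, y]" "x \<in> {..4}" "y \<in> {..4}" "x \<noteq> c" "y \<noteq> c"
    "dist (pos x) (pos c) + dist (pos y) (pos c) \<le> 10"
proof -
  obtain x z y where \<pi>: "\<pi> = [x, z, y]"
    using feasible_sortie_length[OF assms(1)] by (auto simp: numeral_3_eq_3 length_Suc_conv)
  have "z = c" using assms(2) \<pi> unfolding served_def by simp
  moreover have "x \<in> {..4}" "y \<in> {..4}" "x \<noteq> z" "z \<noteq> y"
    using assms(1) \<pi> unfolding feasible_sortie_def is_sortie_def by simp_all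
  moreover have "dist (pos x) (pos z) + dist (pos y) (pos z) \<le> 10"
    using assms(1) \<pi> unfolding feasible_sortie_def energy_two_hubs
    by (simp add: duration_two_hubs)
  ultimately show ?thesis using that \<pi> by simp
qed

text \<open>Two legs of length 5 from hub 1 use the battery exactly; replacing either end by another
  node gives at least 6 + 5 > 10.\<close>

lemma sortie_to_4:
  assumes "feasible_sortie two_hubs \<pi>" "4 \<in> served \<pi>"
  shows "\<pi> = [1, 4, 1]"
proof -
  obtain x y where \<pi>: "\<pi> = [x, 4, y]" "x \<in> {..4}" "y \<in> {..4}" "x \<noteq> 4" "y \<noteq> 4"
    "dist (pos x) (pos 4) + dist (pos y) (pos 4) \<le> 10"
    using feasible_sortieE[OF assms] .
  then show ?thesis
    using dist_pos_4_ge[of x] dist_pos_4_ge[of y] dist_pos_14 by (cases "x = 1"; cases "y = 1") auto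
qed

lemma sortie_to_23:
  assumes "feasible_sortie two_hubs \<pi>" "c \<in> served \<pi>" "c = 2 \<or> c = 3"
  shows "\<pi> = [0, c, 0]"
proof -
  obtain x y where \<pi>: "\<pi> = [x, c, y]" "x \<in> {..4}" "y \<in> {..4}" "x \<noteq> c" "y \<noteq> c"
    "dist (pos x) (pos c) + dist (pos y) (pos c) \<le> 10"
    using feasible_sortieE[OF assms(1,2)] .
  then show ?thesis
    using dist_pos_23_ge[OF assms(3), of x] dist_pos_23_ge[OF assms(3), of y] dist_pos_0[OF assms(3)]
    by (cases "x = 0"; cases "y = 0") auto
qed

section \<open>Lower bound and short schedules\<close>

locale two_hubs_solution = scheduled_solution two_hubs S arr dep lau for S arr dep lau
begin

text \<open>The truck needs 9/4 to reach this customer and 9/4 to return.\<close>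

lemma node_4_off_route:
  assumes "dep (last_visit S) < 9/2"
  shows "4 \<notin> set (route S)"
proof
  assume "4 \<in> set (route S)"
  then obtain t where t: "t \<le> last_visit S" "route S ! t = 4"
    by (rule visitE)
  then show False
    using depot_to_visit[OF t(1)] visit_to_depot[OF t(1)] arr_le_dep[OF t(1)] assms dist_pos_04
    by (simp add: dist_commute)
qed

lemma flight_to_4:
  assumes "dep (last_visit S) < 9/2"
  obtains d k where "d < 2" "k < length (flights S d)" "sortie (flights S d ! k) = [1, 4, 1]"
proof -
  have "4 \<in> nodes two_hubs" by simp
  then obtain d k where dk: "d < num_drones two_hubs" "k < length (flights S d)"
    "4 \<in> served (sortie (flights S d ! k))"
    using node_4_off_route[OF assms] by (rule served_by_flight)
  have "sortie (flights S d ! k) = [1, 4, 1]"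
    using flightD(1)[OF dk(1,2)] dk(3) by (rule sortie_to_4)
  then show ?thesis using that dk by simp
qed

text \<open>Hub 1 is one truck unit from the depot, both before the launch and after the retrieval,
  and the flight takes two units. The sum 1 + 2 + 1 is the lower bound 4.\<close>

lemma flight_to_4_times:
  assumes "d < 2" "k < length (flights S d)" "sortie (flights S d ! k) = [1, 4, 1]"
  shows "1 \<le> lau d k" "lau d k + 2 \<le> dep (retrieval_visit (flights S d ! k))"
    "dep (retrieval_visit (flights S d ! k)) + 1 \<le> dep (last_visit S)"
    "1 \<le> arr (launch_visit (flights S d ! k))"
proof -
  note f = flightD[of d k, simplified, OF assms(1,2), unfolded assms(3), simplified]
  show "1 \<le> arr (launch_visit (flights S d ! k))"
    using depot_to_visit[OF f(2)] dist_pos_01 by (simp flip: f(5))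
  then show "1 \<le> lau d k" using f(7) by simp
  show "lau d k + 2 \<le> dep (retrieval_visit (flights S d ! k))"
    using f(9) dist_pos_14 by (simp add: duration_two_hubs)
  show "dep (retrieval_visit (flights S d ! k)) + 1 \<le> dep (last_visit S)"
    using visit_to_depot[OF f(3)] dist_pos_01 by (simp add: dist_commute flip: f(6))
qed

lemma end_ge_4: "4 \<le> dep (last_visit S)"
proof (rule ccontr)
  assume *: "\<not> 4 \<le> dep (last_visit S)"
  then have "dep (last_visit S) < 9/2" by simp
  then obtain d k where "d < 2" "k < length (flights S d)" "sortie (flights S d ! k) = [1, 4, 1]"
    by (rule flight_to_4)
  from flight_to_4_times[OF this] * show False by simp
qed

lemma duration_ge: "d < 2 \<Longrightarrow> k < length (flights S d) \<Longrightarrow> 8/5 \<le> duration two_hubs (sortie (flights S d ! k))"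
  using flightD(1)[of d k] duration_two_hubs_ge[of "sortie (flights S d ! k)"]
    feasible_sortie_length[of "sortie (flights S d ! k)"]
  unfolding feasible_sortie_def by simp

text \<open>The slack of 1/10 above the optimum 4 is smaller than every gap used in the argument, so
  the critical visits keep the order they have at the exact optimum.\<close>

lemma short_arc_retraversing:
  assumes short: "dep (last_visit S) < 41/10"
  shows "arc_retraversing S"
proof -
  let ?n = "last_visit S"
  have "dep ?n < 9/2" using short by simp
  then obtain d0 k0 where k0: "d0 < 2" "k0 < length (flights S d0)" "sortie (flights S d0 ! k0) = [1, 4, 1]"
    by (rule flight_to_4)
  define f where "f = flights S d0 ! k0"
  define s where "s = launch_visit f"
  define e where "e = retrieval_visit f"
  note f = flightD[of d0 k0, simplified, OF k0(1,2), unfolded k0(3), simplified, folded f_def, folded s_def e_def]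
  note ft = flight_to_4_times[OF k0, folded f_def, folded s_def e_def]
  have s: "s \<le> ?n" "route S ! s = 1" "arr s < 11/10" "1 \<le> dep s"
    using f ft short by auto
  have e: "e \<le> ?n" "route S ! e = 1" "arr e < 31/10" "3 \<le> dep e"
    using f ft short by auto
  \<comment> \<open>By truck such a customer is at least 6/4 away from hub 1, which fits neither
    before \<open>s\<close>, nor after \<open>e\<close>, nor as a detour between them.\<close>
  have off: "c \<notin> set (route S)" if c: "c = 2 \<or> c = 3" for c
  proof
    assume "c \<in> set (route S)"
    then obtain t where t: "t \<le> ?n" "route S ! t = c"
      by (rule visitE)
    have dc: "6 \<le> dist (pos 1) (pos c)" "6 \<le> dist (pos c) (pos 1)"
      using dist_pos_23_ge[OF c, of 1] c by (auto simp: dist_commute)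
    have "t \<noteq> s" "t \<noteq> e" using t s e c by auto
    moreover have "\<not> t < s"
      using travel[of t s] s t dc arr_nonneg[of t] arr_le_dep[of t] by auto
    moreover have "\<not> e < t"
      using travel[of e t] e t dc arr_le_dep[of t] dep_le_end[of t] short by auto
    moreover have "\<not> (s < t \<and> t < e)"
      using travel[of s t] travel[of t e] s t e dc arr_le_dep[of t] by auto
    ultimately show False by linarith
  qed
  \<comment> \<open>Every flight lasts at least 8/5. An earlier one would end after 11/10, too late
    for the launch to customer 4; a later one would start at 3 or after and end beyond
    41/10.\<close>
  have only: "k = k0" if "k < length (flights S d0)" for k
  proof (rule ccontr)
    assume "k \<noteq> k0"
    then consider "k < k0" | "k0 < k" by linarith
    then show False
    proof cases
      case 1
      then show False
        using flights_sequential[of d0 k k0] k0 duration_ge[of d0 k] that ft(2,3) short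
          flight_within(1)[of d0 k] by simp
    next
      case 2
      then show False
        using flights_sequential[of d0 k0 k] k0 duration_ge[of d0 k] that ft(1) short
          flight_within(2)[of d0 k] dist_pos_14 by (simp add: duration_two_hubs)
    qed
  qed
  have other: "\<exists>k < length (flights S (1 - d0)). sortie (flights S (1 - d0) ! k) = [0, c, 0]"
    if c: "c = 2 \<or> c = 3" for c
  proof -
    have "c \<in> nodes two_hubs" using c by auto
    then obtain d k where dk: "d < num_drones two_hubs" "k < length (flights S d)"
      "c \<in> served (sortie (flights S d ! k))"
      using off[OF c] by (rule served_by_flight)
    have so: "sortie (flights S d ! k) = [0, c, 0]"
      using flightD(1)[OF dk(1,2)] dk(3) c by (rule sortie_to_23)
    have "d \<noteq> d0"
    proof
      assume "d = d0"
      then have "k = k0" using only dk(2) by simp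
      then show False using so k0(3) \<open>d = d0\<close> by simp
    qed
    then have "d = 1 - d0" using dk(1) k0(1) by simp
    then show ?thesis using so dk(2) by blast
  qed
  define d where "d = 1 - d0"
  have d2: "d < 2" unfolding d_def by simp
  have dur: "duration two_hubs [0, c, 0] = 2" if "c = 2 \<or> c = 3" for c
    using dist_pos_0[OF that] by (simp add: duration_two_hubs)
  \<comment> \<open>Which of the customers 2 and 3 comes first is unknown, so \<open>c\<close> and
    \<open>c'\<close> cover both orders.\<close>
  obtain j k c c' where jk: "j < k" "k < length (flights S d)"
      "sortie (flights S d ! j) = [0, c, 0]" "sortie (flights S d ! k) = [0, c', 0]"
      "c = 2 \<or> c = 3" "c' = 2 \<or> c' = 3"
  proof -
    obtain k2 where k2: "k2 < length (flights S d)" "sortie (flights S d ! k2) = [0, 2, 0]"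
      using other[of 2] unfolding d_def by blast
    obtain k3 where k3: "k3 < length (flights S d)" "sortie (flights S d ! k3) = [0, 3, 0]"
      using other[of 3] unfolding d_def by blast
    have "k2 \<noteq> k3" using k2 k3 by auto
    then consider "k2 < k3" | "k3 < k2" by linarith
    then show ?thesis
    proof cases
      case 1
      then show ?thesis using that[of k2 k3 2 3] k2 k3 by simp
    next
      case 2
      then show ?thesis using that[of k3 k2 3 2] k2 k3 by simp
    qed
  qed
  have 1: "2 \<le> lau d k"
    using flights_sequential[of d j k] flight_within(1)[of d j] d2 jk dur[OF jk(5)] by simp
  have 2: "lau d k < 21/10"
    using flight_within(2)[of d k] d2 jk dur[OF jk(6)] short by simp
  define t where "t = launch_visit (flights S d ! k)"
  have t: "t \<le> ?n" "route S ! t = 0" "arr t < 21/10" "2 \<le> dep t"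
    using flightD[of d k, simplified, OF d2 jk(2), unfolded jk(4), folded t_def] 1 2 by auto
  \<comment> \<open>The times of the three hub visits give \<open>0 < s < t < e < ?n\<close>; with
    at most four arcs this fixes all the indices.\<close>
  have "s \<noteq> 0" using s(2) route_first by (cases s) simp_all
  moreover have "t \<noteq> s" "t \<noteq> e" "e \<noteq> ?n"
    using s(2) t(2) e(2) route_last by auto
  moreover have "\<not> t < s"
    using travel[of t s] s t dist_pos_01 by auto
  moreover have "\<not> e < t"
    using travel[of e t] e t dist_pos_01 by (auto simp: dist_commute)
  moreover have "?n \<le> 4"
  proof -
    have "real ?n \<le> arr ?n"
      by (rule number_of_arcs_le) (use dist_pos_ge_4 in auto)
    then show ?thesis using arr_le_dep[of ?n] short by linarith
  qed
  ultimately have "s = 1" "t = 2" "e = 3" "?n = 4"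
    using \<open>e \<le> ?n\<close> by linarith+
  then show ?thesis
    \<comment> \<open>The repeated arc runs from 0 to 1, starting at visits 0 and 2.\<close>
    unfolding arc_retraversing_def using s t e route_first
    by (intro exI[of _ 0] exI[of _ 2]) (auto simp: numeral_2_eq_2 numeral_3_eq_3)
qed

end

section \<open>The optimal solution\<close>

definition shuttle :: "nat tsp_md_solution" where
  "shuttle = \<lparr>route = [0, 1, 0, 1, 0],
     flights = (\<lambda>d. if d = 0 then
         [\<lparr>launch_visit = 0, retrieval_visit = 2, sortie = [0, 2, 0]\<rparr>,
          \<lparr>launch_visit = 2, retrieval_visit = 4, sortie = [0, 3, 0]\<rparr>]
       else [\<lparr>launch_visit = 1, retrieval_visit = 3, sortie = [1, 4, 1]\<rparr>])\<rparr>"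

lemma feasible_sorties:
  "feasible_sortie two_hubs [0, 2, 0]" "feasible_sortie two_hubs [0, 3, 0]"
  "feasible_sortie two_hubs [1, 4, 1]"
  unfolding feasible_sortie_def is_sortie_def
  using dist_pos_0 dist_pos_14
  by (auto simp: energy_two_hubs duration_two_hubs served_def)

lemma less_2_nat: "(d::nat) < 2 \<longleftrightarrow> d = 0 \<or> d = 1"
  by auto

lemma shuttle_solution: "solution two_hubs shuttle"
proof -
  have "{..4} = {0, 1, 2, 3, 4::nat}" "{..<2} = {0, 1::nat}" by auto
  then have "nodes two_hubs \<subseteq> set (route shuttle) \<union>
      (\<Union>d<num_drones two_hubs. \<Union>f \<in> set (flights shuttle d). served (sortie f))"
    by (simp add: shuttle_def served_def)
  moreover have "truck_route two_hubs (route shuttle)"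
    by (simp add: truck_route_def shuttle_def)
  moreover have "\<forall>d<num_drones two_hubs. \<forall>f \<in> set (flights shuttle d). valid_flight two_hubs shuttle f"
    using feasible_sorties
    by (simp add: less_2_nat all_conj_distrib valid_flight_def shuttle_def last_visit_def)
  moreover have "\<forall>d<num_drones two_hubs. \<forall>k. Suc k < length (flights shuttle d) \<longrightarrow>
      retrieval_visit (flights shuttle d ! k) \<le> launch_visit (flights shuttle d ! Suc k)"
    by (simp add: less_2_nat shuttle_def)
  ultimately show ?thesis unfolding solution_def by blast
qed

text \<open>Each arc takes one unit and each drone lands exactly when the truck is back at its hub,
  so nobody waits and both \<open>arr\<close> and \<open>dep\<close> are the visit number, that is
  \<open>real\<close>.\<close>

lemma shuttle_schedule:
  "valid_schedule two_hubs shuttle real real (\<lambda>d k. if d = 0 then 2 * real k else 1)"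
  unfolding valid_schedule_def shuttle_def last_visit_def retrieval_time_def
  using dist_pos_01 dist_pos_0[of 2] dist_pos_0[of 3] dist_pos_14
  by (auto simp: less_2_nat less_Suc_eq duration_two_hubs dist_commute numeral_2_eq_2 numeral_3_eq_3)

lemma shuttle_completion_time: "completion_time two_hubs shuttle \<le> 4"
  using completion_time_le[OF two_hubs_instance shuttle_solution shuttle_schedule]
  by (simp add: last_visit_def shuttle_def)

lemma completion_time_ge_4:
  assumes "solution two_hubs S"
  shows "4 \<le> completion_time two_hubs S"
proof (rule completion_time_ge[OF two_hubs_instance assms])
  fix arr dep lau
  assume "valid_schedule two_hubs S arr dep lau"
  then interpret two_hubs_solution S arr dep lau
    using assms two_hubs_instance by unfold_locales
  show "4 \<le> dep (last_visit S)" by (rule end_ge_4)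
qed

lemma shuttle_optimal: "optimal_solution two_hubs shuttle"
  unfolding optimal_solution_def
  using shuttle_solution shuttle_completion_time completion_time_ge_4 by force

text \<open>An optimal solution has completion time at most 4, hence some schedule ending before
  41/10, and the existence of one such schedule already determines the route.\<close>

lemma optimal_arc_retraversing:
  assumes "optimal_solution two_hubs S"
  shows "arc_retraversing S"
proof -
  have sol: "solution two_hubs S" and "completion_time two_hubs S < 41/10"
    using assms shuttle_solution shuttle_completion_time unfolding optimal_solution_def by force+
  then obtain arr dep lau
    where sched: "valid_schedule two_hubs S arr dep lau" and "dep (last_visit S) < 41/10"
    using completion_time_less[OF two_hubs_instance] by blast
  then interpret two_hubs_solution S arr dep lau
    using sol two_hubs_instance by unfold_locales
  show ?thesis by (rule short_arc_retraversing) fact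
qed

text \<open>The conjunct asserting that an optimal solution exists keeps the claim about all optimal
  solutions from being vacuous.\<close>

theorem proposition4p2:
  shows "\<exists>I :: nat tsp_md.
    tsp_md_instance I \<and> euclidean_metrics I \<and>
    (\<forall>i \<in> drone_nodes I. payload I i = 0) \<and>
    nodes I = drone_nodes I \<and> nodes I = truck_nodes I \<and>
    (\<forall>\<pi>. feasible_sortie I \<pi> \<longrightarrow> length \<pi> = 3) \<and>
    (\<exists>S. optimal_solution I S) \<and>
    (\<forall>S. optimal_solution I S \<longrightarrow> arc_retraversing S)"
  using two_hubs_instance two_hubs_euclidean feasible_sortie_length shuttle_optimal
    optimal_arc_retraversing
  by (intro exI[of _ two_hubs]) auto

end
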